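(* A graph $H$ is $k$-common for all integers $k\ge 2$ if and only if $H$ is Sidorenko.
   Context: Graphs are finite and simple; $\|H\|$ is the number of edges of $H$. A graphon is a symmetric measurable function $W:[0,1]^2\to[0,1]$; the homomorphism density of $H$ in $W$ is $t(H,W)=\int_{[0,1]^{V(H)}}\prod_{uv\in E(H)}W(x_u,x_v)\,dx_{V(H)}$, and the density of $W$ is $t(K_2,W)$. $H$ is Sidorenko if $t(H,W)\ge t(K_2,W)^{\|H\|}$ for every graphon $W$. $H$ is $k$-common if $t(H,W_1)+\cdots+t(H,W_k)\ge k^{-\|H\|+1}$ for all graphons $W_1,\dots,W_k$ with $W_1+\cdots+W_k=1$ everywhere (equivalently, every $k$-edge-coloring of $K_N$ has at least $(1-o(1))N^{|V(H)|}/k^{\|H\|-1}$ monochromatic labeled copies of $H$). *)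

theory Defs
  imports "HOL-Analysis.Analysis"
begin

record 'v graph =
  verts :: "'v set"
  edges :: "'v set set"

definition finite_simple_graph :: "'v graph \<Rightarrow> bool" where
  "finite_simple_graph H \<longleftrightarrow>
     finite (verts H) \<and> (\<forall>e\<in>edges H. e \<subseteq> verts H \<and> card e = 2)"

definition K2 :: "nat graph" where
  "K2 = \<lparr>verts = {0, 1}, edges = {{0, 1}}\<rparr>"

text \<open>
  A graphon is represented by a function on the whole plane; only its values on the unit
  square matter. Measurability is Lebesgue measurability, which includes all Borel functions.
\<close>

definition graphon :: "(real \<Rightarrow> real \<Rightarrow> real) \<Rightarrow> bool" where
  "graphon W \<longleftrightarrow>
     (\<lambda>(x, y). W x y) \<in> borel_measurable (lebesgue_on ({0..1} \<times> {0..1})) \<and>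
     (\<forall>x\<in>{0..1}. \<forall>y\<in>{0..1}. W x y = W y x \<and> W x y \<in> {0..1})"

text \<open>
  Lebesgue measure on the cube of all maps from the vertex set to the unit interval. The
  completion is needed: for a graphon that is not Borel, the map sending a point with
  coordinates \<open>x u\<close> and \<open>x v\<close> to \<open>W (x u) (x v)\<close> need not be measurable for the
  uncompleted product, and the Bochner integral of a non-measurable function is 0.
\<close>

definition unit_cube :: "'v set \<Rightarrow> ('v \<Rightarrow> real) measure" where
  "unit_cube V = completion (PiM V (\<lambda>_. restrict_space lborel {0..1}))"

text \<open>
  The factor contributed by an unordered edge. It is well defined because a graphon is
  symmetric; see the lemma below.
\<close>

definition edge_weight :: "(real \<Rightarrow> real \<Rightarrow> real) \<Rightarrow> ('v \<Rightarrow> real) \<Rightarrow> 'v set \<Rightarrow> real" where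
  "edge_weight W x e = (THE r. \<forall>u v. e = {u, v} \<longrightarrow> r = W (x u) (x v))"

lemma edge_weight_doubleton:
  assumes "graphon W" and "x u \<in> {0..1}" and "x v \<in> {0..1}"
  shows "edge_weight W x {u, v} = W (x u) (x v)"
proof -
  have "W (x u) (x v) = W (x v) (x u)"
    using assms unfolding graphon_def by blast
  then show ?thesis
    unfolding edge_weight_def by (intro the_equality) (auto simp: doubleton_eq_iff)
qed

definition hom_density :: "'v graph \<Rightarrow> (real \<Rightarrow> real \<Rightarrow> real) \<Rightarrow> real" where
  "hom_density H W = (\<integral>x. (\<Prod>e\<in>edges H. edge_weight W x e) \<partial>unit_cube (verts H))"

definition sidorenko :: "'v graph \<Rightarrow> bool" where
  "sidorenko H \<longleftrightarrow>
     (\<forall>W. graphon W \<longrightarrow> hom_density H W \<ge> hom_density K2 W ^ card (edges H))"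

definition k_common :: "nat \<Rightarrow> 'v graph \<Rightarrow> bool" where
  "k_common k H \<longleftrightarrow>
     (\<forall>W :: nat \<Rightarrow> real \<Rightarrow> real \<Rightarrow> real.
        (\<forall>i\<in>{1..k}. graphon (W i)) \<and>
        (\<forall>x\<in>{0..1}. \<forall>y\<in>{0..1}. (\<Sum>i=1..k. W i x y) = 1) \<longrightarrow>
        (\<Sum>i=1..k. hom_density H (W i)) \<ge> real k powi (- int (card (edges H)) + 1))"

end

theory Submission
  imports Defs "HOL-Probability.Probability" "HOL-Combinatorics.Permutations"
begin

text \<open>
  If $H$ is Sidorenko, then $k$-commonness follows by convexity of $d \mapsto d^m$, $m = \|H\|$,
  since the densities of $W_1,\dots,W_k$ sum to 1.

  For the converse, let $W$ be a graphon, sample $x_0,\dots,x_n$ independently from the unit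
  interval, and let $a$ be the average of $W(x_i,x_j)$ over $i \ne j$. Use the permutations
  $\sigma$ of $\{0,\dots,n\}$ as colours: colour $\sigma$ is the step function with value
  proportional to $W(x_{\sigma i},x_{\sigma j})$ on block $(i,j)$ off the diagonal and to $a$ on
  the diagonal blocks. With the common factor $1/((n+1)!\,a)$ these sum to exactly 1, so
  $(n+1)!$-commonness bounds the average over $\sigma$ of the densities of $H$ in the unscaled step
  functions from below by $a^m$. Now take expectations over $x$: that of $a^m$ is at least $t(K_2,W)^m$
  by Jensen, while in the densities every placement of the vertices of $H$ in distinct blocks
  contributes exactly $t(H,W)$, and the other placements have vanishing probability as
  $n \to \infty$.
\<close>

section \<open>Uniform measure on cubes and its two-dimensional marginals\<close>

abbreviation unit_measure :: "real measure" where
  "unit_measure \<equiv> restrict_space lborel {0..1}"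

abbreviation cube :: "'v set \<Rightarrow> ('v \<Rightarrow> real) measure" where
  "cube V \<equiv> PiM V (\<lambda>_. unit_measure)"

lemma prob_space_unit_measure: "prob_space unit_measure"
  by (rule prob_spaceI) (simp add: emeasure_restrict_space space_restrict_space)

lemma prob_space_cube: "prob_space (cube V)"
  by (intro prob_space_PiM prob_space_unit_measure)

lemma space_cubeD: "y \<in> space (cube V) \<Longrightarrow> v \<in> V \<Longrightarrow> y v \<in> {0..1}"
  by (auto simp: space_PiM space_restrict_space PiE_def Pi_def)

lemma measurable_cube_component:
  assumes "v \<in> V"
  shows "(\<lambda>y. y v) \<in> borel_measurable (cube V)"
proof -
  have "(\<lambda>x. x) \<in> borel_measurable unit_measure"
    by (intro measurable_restrict_space1) simp
  from measurable_compose[OF measurable_component_singleton[OF assms] this] show ?thesis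
    by simp
qed

text \<open>Reindexing a product measure along the injection \<open>case_bool u v\<close> gives the
  cube over \<open>bool\<close>, which is a binary product in disguise. Distinctness of
  \<open>u\<close> and \<open>v\<close> is what makes the two coordinates independent.\<close>

lemma distr_cube_pair:
  assumes "u \<in> V" "v \<in> V" "u \<noteq> v"
  shows "distr (cube V) (unit_measure \<Otimes>\<^sub>M unit_measure) (\<lambda>y. (y u, y v)) =
    unit_measure \<Otimes>\<^sub>M unit_measure"
proof -
  interpret prob_space unit_measure by (rule prob_space_unit_measure)
  let ?f = "case_bool u v" and ?P = "unit_measure \<Otimes>\<^sub>M unit_measure"
  have f: "inj ?f" "range ?f \<subseteq> V"
    using assms by (auto simp: inj_def split: bool.splits)
  have R: "distr (cube V) (cube UNIV) (\<lambda>\<omega>. \<lambda>n\<in>UNIV. \<omega> (?f n)) = cube UNIV"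
    by (rule distr_PiM_reindex) (use f prob_space_unit_measure in auto)
  have cb: "case_bool unit_measure unit_measure = (\<lambda>_. unit_measure)"
    by (auto simp: fun_eq_iff split: bool.splits)
  have m1: "(\<lambda>\<omega>. \<lambda>n\<in>UNIV. \<omega> (?f n)) \<in> measurable (cube V) (cube UNIV)"
    by (intro measurable_restrict measurable_component_singleton) (use f in auto)
  have m2: "(\<lambda>x. (x True, x False)) \<in> measurable (cube UNIV) ?P"
    by (intro measurable_Pair measurable_component_singleton) auto
  have "?P = distr (cube UNIV) ?P (\<lambda>x. (x True, x False))"
    using pair_measure_eq_distr_PiM[OF sigma_finite_measure_axioms sigma_finite_measure_axioms]
    unfolding cb .
  also have "\<dots> = distr (distr (cube V) (cube UNIV) (\<lambda>\<omega>. \<lambda>n\<in>UNIV. \<omega> (?f n))) ?P (\<lambda>x. (x True, x False))"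
    unfolding R ..
  also have "\<dots> = distr (cube V) ?P (\<lambda>y. (y u, y v))"
    by (subst distr_distr[OF m2 m1]) (simp add: comp_def)
  finally show ?thesis by simp
qed

lemma AE_cube_pair:
  assumes "u \<in> V" "v \<in> V" "u \<noteq> v" "AE z in unit_measure \<Otimes>\<^sub>M unit_measure. Q z"
  shows "AE y in cube V. Q (y u, y v)"
proof (rule AE_distrD[where f = "\<lambda>y. (y u, y v)" and P = Q])
  show "(\<lambda>y. (y u, y v)) \<in> measurable (cube V) (unit_measure \<Otimes>\<^sub>M unit_measure)"
    using assms by (intro measurable_Pair measurable_component_singleton)
  show "AE z in distr (cube V) (unit_measure \<Otimes>\<^sub>M unit_measure) (\<lambda>y. (y u, y v)). Q z"
    unfolding distr_cube_pair[OF assms(1-3)] by (rule assms(4))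
qed

text \<open>By Fubini almost all sections of a null set are null, and this survives restricting each
  coordinate to the interval. The exceptional set is first enlarged to a Borel null set
  \<open>N\<close>, because assembling sections again requires measurability.\<close>

lemma AE_unit_square:
  assumes "AE z in lborel. Q (z :: real \<times> real)"
  shows "AE z in unit_measure \<Otimes>\<^sub>M unit_measure. Q z"
proof -
  interpret prob_space unit_measure by (rule prob_space_unit_measure)
  interpret pair_prob_space unit_measure unit_measure ..
  from assms obtain N where N: "{z \<in> space lborel. \<not> Q z} \<subseteq> N" "emeasure lborel N = 0"
      "N \<in> sets lborel"
    by (rule AE_E)
  have "AE z in lborel. z \<notin> N"
    using N by (intro AE_not_in) (auto simp: null_sets_def)
  then have "AE z in (lborel :: real measure) \<Otimes>\<^sub>M (lborel :: real measure). z \<notin> N"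
    unfolding lborel_prod .
  then have "AE x in (lborel :: real measure). AE y in (lborel :: real measure). (x, y) \<notin> N"
    by (rule lborel_pair.AE_pair)
  then have ae: "AE x in unit_measure. AE y in unit_measure. (x, y) \<notin> N"
    by (simp add: AE_restrict_space_iff) (auto elim!: eventually_mono)
  have "(\<lambda>x. x) \<in> measurable unit_measure borel"
    by (intro measurable_restrict_space1) simp
  then have "(\<lambda>z. (fst z, snd z)) \<in> measurable (unit_measure \<Otimes>\<^sub>M unit_measure) (borel \<Otimes>\<^sub>M borel)"
    by (intro measurable_Pair) (auto intro: measurable_compose[OF measurable_fst] measurable_compose[OF measurable_snd])
  then have "(\<lambda>z. z) \<in> measurable (unit_measure \<Otimes>\<^sub>M unit_measure) borel"
    by (simp add: borel_prod)
  from measurable_sets[OF this, of "- N"] N(3)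
  have "- N \<inter> space (unit_measure \<Otimes>\<^sub>M unit_measure) \<in> sets (unit_measure \<Otimes>\<^sub>M unit_measure)"
    by auto
  then have "{z \<in> space (unit_measure \<Otimes>\<^sub>M unit_measure). z \<notin> N} \<in> sets (unit_measure \<Otimes>\<^sub>M unit_measure)"
    by (simp add: Int_def conj_commute)
  from AE_pair_measure[OF this ae] show ?thesis
    using N(1) by (auto elim!: eventually_mono)
qed

text \<open>The diagonal of the plane is null. This is why vertices of \<open>H\<close> almost
  surely end up in distinct blocks once the blocks are fine enough.\<close>

lemma AE_cube_inj_on:
  assumes "finite V"
  shows "AE y in cube V. inj_on y V"
proof -
  have *: "AE y in cube V. y u \<noteq> y v" if "u \<in> V" "v \<in> V" "u \<noteq> v" for u v
  proof -
    have ae: "AE x in (lborel :: real measure). AE y in (lborel :: real measure). x \<noteq> y"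
      using AE_lborel_singleton by (auto simp: eq_commute)
    have "AE z in (lborel :: real measure) \<Otimes>\<^sub>M (lborel :: real measure). fst z \<noteq> snd z"
    proof (rule lborel_pair.AE_pair_measure)
      have "{z :: real \<times> real. fst z \<noteq> snd z} \<in> sets borel"
        by (intro borel_open open_Collect_neq continuous_intros)
      then show "{z \<in> space (lborel \<Otimes>\<^sub>M lborel). fst z \<noteq> snd z}
          \<in> sets ((lborel :: real measure) \<Otimes>\<^sub>M (lborel :: real measure))"
        unfolding lborel_prod by simp
    qed (use ae in simp)
    then have "AE z in (lborel :: (real \<times> real) measure). fst z \<noteq> snd z"
      unfolding lborel_prod .
    from AE_cube_pair[OF that AE_unit_square[OF this]] show ?thesis by simp
  qed
  have "AE y in cube V. \<forall>u\<in>V. \<forall>v\<in>V. u \<noteq> v \<longrightarrow> y u \<noteq> y v"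
    using assms * by (auto intro!: AE_finite_allI)
  then show ?thesis by eventually_elim (auto simp: inj_on_def)
qed

section \<open>Replacing graphons by Borel functions on the whole plane\<close>

definition borel_graphon :: "(real \<Rightarrow> real \<Rightarrow> real) \<Rightarrow> bool" where
  "borel_graphon W \<longleftrightarrow> (\<lambda>(x, y). W x y) \<in> borel_measurable borel \<and>
     (\<forall>x y. W x y = W y x) \<and> (\<forall>x y. W x y \<in> {0..1})"

text \<open>A Lebesgue measurable function agrees almost everywhere with a Borel function
  \<open>g\<close>. Symmetrizing and clamping \<open>g\<close> makes symmetry and range hold
  everywhere, and changes nothing at points where \<open>g\<close> agrees with \<open>W\<close> both
  there and at the mirror image.\<close>

lemma graphon_borel_version:
  assumes "graphon W"
  obtains W' where "borel_graphon W'"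
    "AE z in unit_measure \<Otimes>\<^sub>M unit_measure. W (fst z) (snd z) = W' (fst z) (snd z)"
proof -
  let ?I = "{0..1} \<times> {0..1} :: (real \<times> real) set"
  have "(\<lambda>z. if z \<in> ?I then case_prod W z else 0) \<in> borel_measurable lebesgue"
    using assms lborelD[of ?I] unfolding graphon_def
    by (subst borel_measurable_if) (auto simp: borel_Times case_prod_unfold)
  from completion_ex_borel_measurable_real[OF this] obtain g where
    g: "g \<in> borel_measurable lborel" and
    ae: "AE z in lborel. (if z \<in> ?I then case_prod W z else 0) = g z"
    by auto
  have g' [measurable]: "g \<in> borel_measurable (borel \<Otimes>\<^sub>M borel)"
    using g by (simp add: borel_prod)
  define W' where "W' x y = max 0 (min 1 ((g (x, y) + g (y, x)) / 2))" for x y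
  have "(\<lambda>(x, y). W' x y) \<in> borel_measurable (borel \<Otimes>\<^sub>M borel)"
    unfolding W'_def by measurable
  then have bg: "borel_graphon W'"
    by (auto simp: borel_graphon_def W'_def borel_prod add.commute)
  \<comment> \<open>Lebesgue measure is invariant under swapping coordinates, so the mirror image of
    the exceptional set is null too.\<close>
  have "AE z in distr (lborel \<Otimes>\<^sub>M lborel) (lborel \<Otimes>\<^sub>M lborel) (\<lambda>(x, y). (y, x)).
      (if z \<in> ?I then case_prod W z else 0) = g z"
    unfolding lborel_pair.distr_pair_swap[symmetric] unfolding lborel_prod by (rule ae)
  from AE_distrD[OF measurable_pair_swap' this]
  have "AE z in lborel. (if (case z of (x, y) \<Rightarrow> (y, x)) \<in> ?I
      then case_prod W (case z of (x, y) \<Rightarrow> (y, x)) else 0) = g (case z of (x, y) \<Rightarrow> (y, x))"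
    unfolding lborel_prod .
  with ae have "AE z in lborel. z \<in> ?I \<longrightarrow> W (fst z) (snd z) = W' (fst z) (snd z)"
  proof eventually_elim
    case (elim z)
    show ?case
    proof
      assume z: "z \<in> ?I"
      then have "W (fst z) (snd z) = W (snd z) (fst z)" "W (fst z) (snd z) \<in> {0..1}"
        using assms unfolding graphon_def by auto
      then show "W (fst z) (snd z) = W' (fst z) (snd z)"
        using elim z by (cases z) (auto simp: W'_def)
    qed
  qed
  from AE_unit_square[OF this]
  have "AE z in unit_measure \<Otimes>\<^sub>M unit_measure. W (fst z) (snd z) = W' (fst z) (snd z)"
    using AE_space by eventually_elim (auto simp: space_pair_measure space_restrict_space)
  with bg show thesis by (rule that)
qed

text \<open>Measurability of \<open>f\<close> is derived, not assumed: in a complete measure space,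
  changing \<open>g\<close> on a null set preserves it. This moves densities from the completed cube
  to the plain product.\<close>

lemma integral_completion_cong_AE:
  fixes f g :: "'a \<Rightarrow> 'b :: {banach, second_countable_topology}"
  assumes g: "g \<in> borel_measurable M" and ae: "AE x in M. f x = g x"
  shows "integral\<^sup>L (completion M) f = integral\<^sup>L M g"
proof -
  have ae': "AE x in completion M. f x = g x"
    using ae by (rule AE_completion)
  have g': "g \<in> borel_measurable (completion M)"
    using g by (rule measurable_completion)
  have "f \<in> borel_measurable (completion M)"
  proof (rule measurableI)
    fix A :: "'b set" assume "A \<in> sets borel"
    then have gA: "g -` A \<inter> space (completion M) \<in> sets (completion M)"
      using g' by (rule measurable_sets[rotated])
    show "f -` A \<inter> space (completion M) \<in> sets (completion M)"
    proof (rule completion.in_sets_AE[OF _ gA])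
      show "AE x in completion M. (x \<in> g -` A \<inter> space (completion M)) = (x \<in> f -` A \<inter> space (completion M))"
        using ae' by eventually_elim auto
    qed auto
  qed simp
  then have "integral\<^sup>L (completion M) f = integral\<^sup>L (completion M) g"
    using g' ae' by (rule integral_cong_AE)
  then show ?thesis
    using g by (simp add: integral_completion)
qed

section \<open>Homomorphism densities as integrals of products over oriented edges\<close>

text \<open>\<open>src\<close> and \<open>tgt\<close> fix an arbitrary orientation of each edge,
  replacing the definite description in \<open>edge_weight\<close>. Symmetry of the kernel makes the
  choice immaterial.\<close>

definition src :: "'v set \<Rightarrow> 'v" where
  "src e = (SOME u. u \<in> e)"

definition tgt :: "'v set \<Rightarrow> 'v" where
  "tgt e = (SOME v. v \<in> e \<and> v \<noteq> src e)"

lemma edge_ends: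
  assumes "finite_simple_graph H" "e \<in> edges H"
  shows "e = {src e, tgt e}" "src e \<noteq> tgt e" "src e \<in> verts H" "tgt e \<in> verts H"
proof -
  from assms have "e \<subseteq> verts H" "card e = 2"
    by (auto simp: finite_simple_graph_def)
  then obtain u v where e: "e = {u, v}" "u \<noteq> v"
    by (auto simp: card_2_iff)
  have s: "src e \<in> e"
    unfolding src_def using e by (intro someI_ex[of "\<lambda>u. u \<in> e"]) auto
  have "\<exists>v. v \<in> e \<and> v \<noteq> src e"
    using e by (metis insertCI)
  then have t: "tgt e \<in> e \<and> tgt e \<noteq> src e"
    unfolding tgt_def by (rule someI_ex[of "\<lambda>v. v \<in> e \<and> v \<noteq> src e"])
  show "e = {src e, tgt e}" "src e \<noteq> tgt e" "src e \<in> verts H" "tgt e \<in> verts H"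
    using s t e \<open>e \<subseteq> verts H\<close> by auto
qed

lemma finite_edges: "finite_simple_graph H \<Longrightarrow> finite (edges H)"
  by (rule finite_subset[of _ "Pow (verts H)"]) (auto simp: finite_simple_graph_def)

definition edge_prod :: "'v graph \<Rightarrow> (real \<Rightarrow> real \<Rightarrow> real) \<Rightarrow> ('v \<Rightarrow> real) \<Rightarrow> real" where
  "edge_prod H W y = (\<Prod>e\<in>edges H. W (y (src e)) (y (tgt e)))"

lemma edge_prod_bounds:
  assumes "borel_graphon W"
  shows "0 \<le> edge_prod H W y" "edge_prod H W y \<le> 1"
  using assms by (auto simp: edge_prod_def borel_graphon_def intro!: prod_nonneg prod_le_1)

lemma edge_prod_scale: "edge_prod H (\<lambda>s t. W s t / c) y = edge_prod H W y / c ^ card (edges H)"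
  by (simp add: edge_prod_def prod_dividef)

lemma borel_graphon_measurable:
  assumes "borel_graphon W" "f \<in> borel_measurable M" "g \<in> borel_measurable M"
  shows "(\<lambda>x. W (f x) (g x)) \<in> borel_measurable M"
proof -
  have "(\<lambda>x. (f x, g x)) \<in> borel_measurable M"
    using measurable_Pair[OF assms(2,3)] by (simp add: borel_prod)
  from measurable_compose[OF this, of "\<lambda>(s, t). W s t" borel]
  have "(\<lambda>x. case (f x, g x) of (s, t) \<Rightarrow> W s t) \<in> borel_measurable M"
    using assms(1) by (simp add: borel_graphon_def)
  then show ?thesis by simp
qed

lemma borel_graphon_imp_graphon:
  assumes "borel_graphon W"
  shows "graphon W"
proof -
  have "(\<lambda>(x, y). W x y) \<in> borel_measurable (lebesgue_on ({0..1} \<times> {0..1}))"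
    using assms unfolding borel_graphon_def
    by (intro measurable_restrict_space1 measurable_completion) simp
  then show ?thesis
    using assms by (auto simp: graphon_def borel_graphon_def)
qed

lemma edge_prod_measurable:
  assumes "finite_simple_graph H" "borel_graphon W"
  shows "edge_prod H W \<in> borel_measurable (cube (verts H))"
  unfolding edge_prod_def[abs_def]
  by (intro borel_measurable_prod borel_graphon_measurable[OF assms(2)]
      measurable_cube_component edge_ends[OF assms(1)])

lemma integrable_edge_prod:
  assumes "finite_simple_graph H" "borel_graphon W"
  shows "integrable (cube (verts H)) (edge_prod H W)"
proof -
  interpret prob_space "cube (verts H)" by (rule prob_space_cube)
  show ?thesis
    by (intro integrable_const_bound[where B = 1] edge_prod_measurable assms AE_I2)
      (simp add: edge_prod_bounds[OF assms(2)])
qed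

text \<open>The endpoints of an edge are distinct, so its pair of coordinates is uniform on the
  square and misses the null set where \<open>W\<close> and \<open>W'\<close> differ. Finitely many
  edges contribute only a null set in total.\<close>

lemma hom_density_eq:
  assumes H: "finite_simple_graph H" and W: "graphon W" and W': "borel_graphon W'"
    and ae: "AE z in unit_measure \<Otimes>\<^sub>M unit_measure. W (fst z) (snd z) = W' (fst z) (snd z)"
  shows "hom_density H W = (\<integral>y. edge_prod H W' y \<partial>cube (verts H))"
proof -
  have "AE y in cube (verts H). edge_weight W y e = W' (y (src e)) (y (tgt e))"
    if e: "e \<in> edges H" for e
  proof -
    note ends = edge_ends[OF H e]
    have "AE y in cube (verts H). W (y (src e)) (y (tgt e)) = W' (y (src e)) (y (tgt e))"
      using AE_cube_pair[OF ends(3,4,2) ae] by simp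
    with AE_space show ?thesis
    proof eventually_elim
      case (elim y)
      have "edge_weight W y e = edge_weight W y {src e, tgt e}"
        using ends(1) by simp
      also have "\<dots> = W (y (src e)) (y (tgt e))"
        using elim ends by (intro edge_weight_doubleton[OF W] space_cubeD)
      finally show ?case using elim by simp
    qed
  qed
  then have "AE y in cube (verts H). \<forall>e\<in>edges H. edge_weight W y e = W' (y (src e)) (y (tgt e))"
    by (intro AE_finite_allI finite_edges[OF H])
  then have "AE y in cube (verts H). (\<Prod>e\<in>edges H. edge_weight W y e) = edge_prod H W' y"
    by eventually_elim (simp add: edge_prod_def)
  with edge_prod_measurable[OF H W'] show ?thesis
    unfolding hom_density_def unit_cube_def by (rule integral_completion_cong_AE)
qed

lemma hom_density_borel_graphon:
  assumes "finite_simple_graph H" "borel_graphon W"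
  shows "hom_density H W = (\<integral>y. edge_prod H W y \<partial>cube (verts H))"
  using assms by (intro hom_density_eq borel_graphon_imp_graphon) auto

text \<open>Distinct coordinates of a uniform sample are again independent and uniform. This gives
  the exact value \<open>hom_density H W\<close> for placements of the vertices in distinct
  blocks.\<close>

lemma integral_cube_reindex:
  assumes H: "finite_simple_graph H" and W: "borel_graphon W"
    and f: "inj_on f (verts H)" "f ` verts H \<subseteq> I"
  shows "(\<integral>x. edge_prod H W (x \<circ> f) \<partial>cube I) = (\<integral>y. edge_prod H W y \<partial>cube (verts H))"
proof -
  let ?r = "\<lambda>x. \<lambda>v\<in>verts H. x (f v)"
  have D: "distr (cube I) (cube (verts H)) ?r = cube (verts H)"
    by (rule distr_PiM_reindex) (use f prob_space_unit_measure in auto)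
  have m: "?r \<in> measurable (cube I) (cube (verts H))"
    by (intro measurable_restrict measurable_component_singleton) (use f in auto)
  \<comment> \<open>The two arguments may differ off \<open>verts H\<close>, but edges only see
    vertices.\<close>
  have r: "edge_prod H W (?r x) = edge_prod H W (x \<circ> f)" for x
    unfolding edge_prod_def using edge_ends[OF H] by (intro prod.cong) auto
  have "(\<integral>y. edge_prod H W y \<partial>cube (verts H)) = (\<integral>x. edge_prod H W (?r x) \<partial>cube I)"
    using integral_distr[OF m edge_prod_measurable[OF H W]] unfolding D .
  then show ?thesis by (simp add: r)
qed

lemma finite_simple_graph_K2: "finite_simple_graph K2"
  by (auto simp: finite_simple_graph_def K2_def)

lemma edge_prod_K2:
  assumes "\<And>s t. W s t = W t s"
  shows "edge_prod K2 W y = W (y 0) (y 1)"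
proof -
  have "{src {0, 1 :: nat}, tgt {0, 1}} = {0, 1}"
    using edge_ends(1)[OF finite_simple_graph_K2, of "{0, 1}"] by (simp add: K2_def)
  then show ?thesis
    using assms by (auto simp: edge_prod_def K2_def doubleton_eq_iff)
qed

lemma integral_cube_pair_eq_K2:
  assumes W: "borel_graphon W" and "i \<in> I" "j \<in> I" "i \<noteq> j"
  shows "(\<integral>x. W (x i) (x j) \<partial>cube I) = hom_density K2 W"
proof -
  define f where "f k = (if k = (0 :: nat) then i else j)" for k
  have f: "edge_prod K2 W (x \<circ> f) = W (x i) (x j)" for x
    by (subst edge_prod_K2) (use W in \<open>auto simp: f_def borel_graphon_def\<close>)
  have "hom_density K2 W = (\<integral>x. edge_prod K2 W (x \<circ> f) \<partial>cube I)"
    unfolding hom_density_borel_graphon[OF finite_simple_graph_K2 W]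
    by (rule integral_cube_reindex[symmetric, OF finite_simple_graph_K2 W])
      (use assms in \<open>auto simp: f_def K2_def inj_on_def\<close>)
  then show ?thesis by (simp add: f)
qed

section \<open>Convexity of powers, and the direction from Sidorenko to common\<close>

text \<open>The right side dominates its tangent line at \<open>p\<close>. In this form Jensen's
  inequality follows by summing or integrating, as the linear term vanishes when \<open>p\<close> is
  the mean. For \<open>m = 0\<close> the truncated exponent is harmless, since its coefficient is
  0.\<close>

lemma power_ge_tangent:
  fixes a p :: real
  assumes "0 \<le> a" "0 \<le> p"
  shows "p ^ m + real m * p ^ (m - 1) * (a - p) \<le> a ^ m"
proof (induction m)
  case (Suc m)
  have "p ^ Suc m + real (Suc m) * p ^ m * (a - p) \<le> a * (p ^ m + real m * p ^ (m - 1) * (a - p))"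
  proof (cases m)
    case (Suc l)
    have "a * (p ^ m + real m * p ^ (m - 1) * (a - p)) - (p ^ Suc m + real (Suc m) * p ^ m * (a - p))
      = real m * p ^ l * (a - p)\<^sup>2"
      unfolding Suc by (simp add: algebra_simps power2_eq_square)
    also have "\<dots> \<ge> 0" using assms by simp
    finally show ?thesis by simp
  qed simp
  also have "\<dots> \<le> a * a ^ m"
    using Suc assms by (intro mult_left_mono)
  finally show ?case by simp
qed simp

lemma real_powi_one_minus:
  assumes "k > 0"
  shows "real k powi (- int m + 1) = real k * (1 / real k) ^ m"
  using assms by (simp add: power_int_diff power_one_over)

lemma sidorenko_imp_k_common:
  assumes H: "finite_simple_graph H" and S: "sidorenko H" and k: "k > 0"
  shows "k_common k H"
  unfolding k_common_def
proof (intro allI impI, elim conjE)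
  fix W :: "nat \<Rightarrow> real \<Rightarrow> real \<Rightarrow> real"
  assume W: "\<forall>i\<in>{1..k}. graphon (W i)"
    and sum1: "\<forall>x\<in>{0..1}. \<forall>y\<in>{0..1}. (\<Sum>i=1..k. W i x y) = 1"
  define m where "m = card (edges H)"
  define p where "p = 1 / real k"
  define d where "d i = hom_density K2 (W i)" for i
  have "\<forall>i\<in>{1..k}. \<exists>W'. borel_graphon W' \<and>
    (AE z in unit_measure \<Otimes>\<^sub>M unit_measure. W i (fst z) (snd z) = W' (fst z) (snd z))"
    using W by (metis graphon_borel_version)
  then obtain V where V: "\<And>i. i \<in> {1..k} \<Longrightarrow> borel_graphon (V i)"
    "\<And>i. i \<in> {1..k} \<Longrightarrow> AE z in unit_measure \<Otimes>\<^sub>M unit_measure. W i (fst z) (snd z) = V i (fst z) (snd z)"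
    by metis
  interpret prob_space "cube (verts K2)" by (rule prob_space_cube)
  have "AE z in unit_measure \<Otimes>\<^sub>M unit_measure. \<forall>i\<in>{1..k}. W i (fst z) (snd z) = V i (fst z) (snd z)"
    using V(2) by (intro AE_finite_allI) auto
  \<comment> \<open>The Borel versions inherit the constant sum only almost everywhere, which
    suffices for integrals.\<close>
  then have ae: "AE z in unit_measure \<Otimes>\<^sub>M unit_measure. (\<Sum>i=1..k. V i (fst z) (snd z)) = 1"
    using AE_space
  proof eventually_elim
    case (elim z)
    then have "(\<Sum>i=1..k. V i (fst z) (snd z)) = (\<Sum>i=1..k. W i (fst z) (snd z))"
      by (intro sum.cong) auto
    also have "\<dots> = 1"
      using elim(2) sum1 by (auto simp: space_pair_measure space_restrict_space)
    finally show ?case .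
  qed
  have d: "d i = (\<integral>y. edge_prod K2 (V i) y \<partial>cube (verts K2))" if "i \<in> {1..k}" for i
    unfolding d_def using that W V by (intro hom_density_eq finite_simple_graph_K2) auto
  have "(\<Sum>i=1..k. d i) = (\<integral>y. (\<Sum>i=1..k. edge_prod K2 (V i) y) \<partial>cube (verts K2))"
    using d V by (subst Bochner_Integration.integral_sum)
      (auto intro!: integrable_edge_prod finite_simple_graph_K2)
  also have "\<dots> = (\<integral>y. 1 \<partial>cube (verts K2))"
  proof (rule integral_cong_AE)
    have "AE y in cube (verts K2). (\<Sum>i=1..k. V i (y 0) (y 1)) = 1"
      using AE_cube_pair[OF _ _ _ ae, of 0 "verts K2" 1] by (simp add: K2_def)
    moreover have "(\<Sum>i=1..k. edge_prod K2 (V i) y) = (\<Sum>i=1..k. V i (y 0) (y 1))" for y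
      using V(1) by (intro sum.cong refl edge_prod_K2) (auto simp: borel_graphon_def)
    ultimately show "AE y in cube (verts K2). (\<Sum>i=1..k. edge_prod K2 (V i) y) = 1"
      by simp
  qed (use V in \<open>auto intro!: borel_measurable_sum edge_prod_measurable finite_simple_graph_K2\<close>)
  finally have d1: "(\<Sum>i=1..k. d i) = 1"
    by (simp add: prob_space)
  have dnn: "d i \<ge> 0" if "i \<in> {1..k}" for i
    unfolding d[OF that] using edge_prod_bounds(1)[OF V(1)[OF that]]
    by (intro integral_nonneg_AE) auto
  have "real k powi (- int m + 1) = real k * p ^ m"
    unfolding p_def using k by (rule real_powi_one_minus)
  \<comment> \<open>The linear terms cancel: the \<open>d i\<close> sum to 1, and so do
    \<open>k\<close> copies of \<open>p\<close>.\<close>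
  also have "\<dots> = (\<Sum>i=1..k. p ^ m + real m * p ^ (m - 1) * (d i - p))"
    using k d1 by (simp add: p_def sum.distrib sum_subtractf flip: sum_distrib_left)
  also have "\<dots> \<le> (\<Sum>i=1..k. d i ^ m)"
    using dnn by (intro sum_mono power_ge_tangent) (auto simp: p_def)
  also have "\<dots> \<le> (\<Sum>i=1..k. hom_density H (W i))"
    using S W by (intro sum_mono) (auto simp: sidorenko_def d_def m_def)
  finally show "(\<Sum>i=1..k. hom_density H (W i)) \<ge> real k powi (- int (card (edges H)) + 1)"
    by (simp add: m_def)
qed

section \<open>Partition of the interval into blocks, and step kernels\<close>

text \<open>The truncation by \<open>n\<close> only matters for \<open>s > 1\<close>; it gives the block kernels below the
  range and sum required of graphons on the whole plane.\<close>

definition block :: "nat \<Rightarrow> real \<Rightarrow> nat" where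
  "block n s = min n (nat \<lfloor>real n * s\<rfloor>)"

lemma block_le: "block n s \<le> n"
  by (simp add: block_def)

lemma block_measurable: "block n \<in> measurable borel (count_space UNIV)"
  unfolding block_def[abs_def] by measurable

text \<open>Below 1, points of the interval in a common block are less than \<open>1 / n\<close>
  apart. The point 1 has block index \<open>n\<close> to itself, so there are \<open>n + 1\<close>
  indices in all.\<close>

lemma block_eventually_neq:
  assumes "s \<in> {0..1}" "t \<in> {0..1}" "s \<noteq> t"
  shows "eventually (\<lambda>n. block n s \<noteq> block n t) sequentially"
proof -
  have *: "eventually (\<lambda>n. block n s < block n t) sequentially"
    if st: "0 \<le> s" "s < t" "t \<le> 1" for s t
  proof -
    obtain m where m: "1 / (t - s) < real m"
      using reals_Archimedean2 by blast
    show ?thesis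
      using eventually_ge_at_top[of "max m 1"]
    proof eventually_elim
      case (elim n)
      have "1 / (t - s) < real n"
        using m elim by linarith
      then have gap: "real n * s + 1 < real n * t"
        using st by (simp add: field_simps)
      \<comment> \<open>This shows that the \<open>min\<close> in \<open>block\<close> is inactive
        on the unit interval.\<close>
      have "real n * t \<le> real n"
        using st by (simp add: mult_left_le)
      then have "\<lfloor>real n * t\<rfloor> \<le> int n"
        by linarith
      moreover have "\<lfloor>real n * s\<rfloor> < \<lfloor>real n * t\<rfloor>" "0 \<le> \<lfloor>real n * s\<rfloor>"
        using gap st by (linarith, simp)
      ultimately have "nat \<lfloor>real n * s\<rfloor> < nat \<lfloor>real n * t\<rfloor>" "nat \<lfloor>real n * t\<rfloor> \<le> n"
        by linarith+
      then show ?case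
        unfolding block_def by linarith
    qed
  qed
  show ?thesis
    using assms *[of s t] *[of t s] by (cases "s < t") (auto elim: eventually_mono)
qed

lemma inj_block_measurable:
  assumes "finite V"
  shows "Measurable.pred (cube V) (\<lambda>y. inj_on (block n \<circ> y) V)"
proof -
  have b: "(\<lambda>y. block n (y v)) \<in> measurable (cube V) (count_space UNIV)" if "v \<in> V" for v
    by (rule measurable_compose[OF measurable_cube_component[OF that] block_measurable])
  have "Measurable.pred (cube V) (\<lambda>y. block n (y u) = block n (y v) \<longrightarrow> u = v)"
    if "u \<in> V" "v \<in> V" for u v
  proof -
    have "Measurable.pred (cube V) (\<lambda>y. i = block n (y v) \<longrightarrow> u = v)" for i
      by (rule measurable_compose[OF b[OF that(2)]]) simp
    from measurable_compose_countable[OF this b[OF that(1)]] show ?thesis .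
  qed
  then show ?thesis
    unfolding inj_on_def comp_def using assms by (intro pred_intros_finite) auto
qed

text \<open>An unscaled colour. The separate diagonal value \<open>c\<close> will be the
  off-diagonal mean of \<open>U\<close>, so that summing over all \<open>\<sigma>\<close> gives the
  same total on every block.\<close>

definition block_kernel :: "nat \<Rightarrow> real \<Rightarrow> (nat \<Rightarrow> nat \<Rightarrow> real) \<Rightarrow> (nat \<Rightarrow> nat) \<Rightarrow> real \<Rightarrow> real \<Rightarrow> real" where
  "block_kernel n c U \<sigma> s t =
    (if block n s = block n t then c else U (\<sigma> (block n s)) (\<sigma> (block n t)))"

section \<open>Averaging over permutations, which serve as colours\<close>

definition perms :: "nat \<Rightarrow> (nat \<Rightarrow> nat) set" where
  "perms n = {\<sigma>. \<sigma> permutes {..n}}"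

lemma finite_perms: "finite (perms n)"
  by (simp add: perms_def finite_permutations)

lemma card_perms: "card (perms n) = fact (Suc n)"
  by (simp add: perms_def card_permutations)

text \<open>For \<open>n \<ge> 1\<close> this is the average of \<open>U i j\<close> over ordered
  pairs of distinct indices up to \<open>n\<close>, because a random permutation sends (0, 1) to a
  uniformly random such pair.\<close>

definition perm_mean :: "nat \<Rightarrow> (nat \<Rightarrow> nat \<Rightarrow> real) \<Rightarrow> real" where
  "perm_mean n U = (\<Sum>\<sigma>\<in>perms n. U (\<sigma> 0) (\<sigma> 1)) / real (card (perms n))"

lemma card_perms_pos: "real (card (perms n)) > 0"
  by (simp add: card_perms del: fact_Suc)

lemma sum_perms_entry:
  assumes "i \<le> n" "j \<le> n" "i \<noteq> j"
  shows "(\<Sum>\<sigma>\<in>perms n. U (\<sigma> i) (\<sigma> j)) = real (card (perms n)) * perm_mean n U"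
proof -
  \<comment> \<open>\<open>\<tau>\<close> carries 0 to \<open>i\<close> and 1 to \<open>j\<close>:
    the first swap settles 0, and the second brings the current image of 1 to \<open>j\<close>
    without moving \<open>i\<close>.\<close>
  define \<tau> where "\<tau> = Transposition.transpose (Transposition.transpose 0 i 1) j \<circ> Transposition.transpose 0 i"
  have n: "1 \<le> n" using assms by auto
  have "Transposition.transpose 0 i 1 \<le> n"
    using assms n by (auto simp: Transposition.transpose_def)
  then have \<tau>: "\<tau> permutes {..n}"
    unfolding \<tau>_def using assms by (intro permutes_compose permutes_swap_id) auto
  have "\<tau> 0 = i" "\<tau> 1 = j"
    using assms by (auto simp: \<tau>_def Transposition.transpose_def)
  then have "(\<Sum>\<sigma>\<in>perms n. U (\<sigma> 0) (\<sigma> 1)) = (\<Sum>\<sigma>\<in>perms n. U (\<sigma> i) (\<sigma> j))"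
    using sum_permutations_compose_right[OF \<tau>, of "\<lambda>\<sigma>. U (\<sigma> i) (\<sigma> j)"]
      sum_permutations_compose_right[OF \<tau>, of "\<lambda>\<sigma>. U (\<sigma> 0) (\<sigma> 1)"]
    by (simp add: perms_def)
  then show ?thesis
    using card_perms_pos[of n] by (simp add: perm_mean_def)
qed

lemma perm_mean_bounds:
  assumes "\<And>i j. U i j \<in> {0..1}"
  shows "0 \<le> perm_mean n U" "perm_mean n U \<le> 1"
proof -
  show "0 \<le> perm_mean n U"
    unfolding perm_mean_def using assms by (intro divide_nonneg_nonneg sum_nonneg) auto
  have "(\<Sum>\<sigma>\<in>perms n. U (\<sigma> 0) (\<sigma> 1)) \<le> (\<Sum>\<sigma>\<in>perms n. 1)"
    using assms by (intro sum_mono) auto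
  then show "perm_mean n U \<le> 1"
    unfolding perm_mean_def using card_perms_pos[of n] by (simp add: divide_le_eq)
qed

lemma block_kernel_measurable:
  "(\<lambda>(s, t). block_kernel n c U \<sigma> s t) \<in> borel_measurable borel"
proof -
  let ?k = "\<lambda>i j. if i = j then c else U (\<sigma> i) (\<sigma> j)"
  have b: "(\<lambda>z. block n (fst z)) \<in> measurable (borel \<Otimes>\<^sub>M borel) (count_space UNIV)"
    "(\<lambda>z. block n (snd z)) \<in> measurable (borel \<Otimes>\<^sub>M borel) (count_space UNIV)"
    using measurable_compose[OF measurable_fst block_measurable]
      measurable_compose[OF measurable_snd block_measurable] by auto
  have "(\<lambda>z. ?k (block n (fst z)) (block n (snd z))) \<in> borel_measurable (borel \<Otimes>\<^sub>M borel)"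
    by (rule measurable_compose_countable[OF measurable_compose_countable[OF _ b(2)] b(1)]) simp
  then show ?thesis
    by (simp add: block_kernel_def case_prod_unfold borel_prod)
qed

lemma borel_graphon_block_kernel:
  assumes "\<And>i j. U i j = U j i" "\<And>i j. U i j \<in> {0..1}" "c \<in> {0..1}"
  shows "borel_graphon (block_kernel n c U \<sigma>)"
  using assms block_kernel_measurable by (auto simp: borel_graphon_def block_kernel_def)

text \<open>Dividing the step kernels by their constant sum \<open>N * a\<close> gives
  \<open>N\<close> graphons that sum to 1. Commonness bounds their total density from below, and
  undoing the scaling cancels the powers of \<open>N\<close>.\<close>

lemma k_common_imp_block_kernel_bound:
  assumes H: "finite_simple_graph H" and kc: "k_common (card (perms n)) H"
    and sym: "\<And>i j. U i j = U j i" and range: "\<And>i j. U i j \<in> {0..1}"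
  shows "real (card (perms n)) * perm_mean n U ^ card (edges H) \<le>
    (\<Sum>\<sigma>\<in>perms n. \<integral>y. edge_prod H (block_kernel n (perm_mean n U) U \<sigma>) y \<partial>cube (verts H))"
proof -
  define N where "N = card (perms n)"
  define a where "a = perm_mean n U"
  define m where "m = card (edges H)"
  define K where "K = block_kernel n a U"
  note N = card_perms_pos[of n, folded N_def]
  have a: "0 \<le> a" "a \<le> 1"
    using perm_mean_bounds[OF range] by (auto simp: a_def)
  have K: "borel_graphon (K \<sigma>)" for \<sigma>
    unfolding K_def using sym range a by (intro borel_graphon_block_kernel) auto
  interpret prob_space "cube (verts H)" by (rule prob_space_cube)
  have "real N * a ^ m \<le> (\<Sum>\<sigma>\<in>perms n. \<integral>y. edge_prod H (K \<sigma>) y \<partial>cube (verts H))"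
  \<comment> \<open>Scaling by \<open>1 / (N * a)\<close> is impossible for \<open>a = 0\<close>.
    Then the left side is 0, unless \<open>H\<close> has no edges and both sides equal
    \<open>N\<close>.\<close>
  proof (cases "a = 0")
    case True
    show ?thesis
    proof (cases "edges H = {}")
      case True
      then show ?thesis by (simp add: m_def edge_prod_def N_def prob_space)
    next
      case False
      then have "m > 0"
        using finite_edges[OF H] by (simp add: m_def card_gt_0_iff)
      moreover have "0 \<le> (\<Sum>\<sigma>\<in>perms n. \<integral>y. edge_prod H (K \<sigma>) y \<partial>cube (verts H))"
        by (intro sum_nonneg integral_nonneg_AE AE_I2 edge_prod_bounds(1)[OF K])
      ultimately show ?thesis
        using \<open>a = 0\<close> by (simp add: zero_power)
    qed
  next
    case False
    with a have a0: "a > 0" by simp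
    define W where "W \<sigma> s t = K \<sigma> s t / (N * a)" for \<sigma> s t
    \<comment> \<open>On a diagonal block all \<open>N\<close> summands equal \<open>a\<close>;
      elsewhere \<open>sum_perms_entry\<close> applies.\<close>
    have sumK: "(\<Sum>\<sigma>\<in>perms n. K \<sigma> s t) = N * a" for s t
      using sum_perms_entry[of "block n s" n "block n t" U] block_le[of n]
      by (cases "block n s = block n t") (simp_all add: K_def block_kernel_def N_def a_def)
    have "(\<lambda>(s, t). W \<sigma> s t) \<in> borel_measurable borel" for \<sigma>
      using K[of \<sigma>] unfolding W_def borel_graphon_def case_prod_unfold
      by (intro borel_measurable_divide borel_measurable_const) auto
    moreover have "W \<sigma> s t = W \<sigma> t s" for \<sigma> s t
      using K[of \<sigma>] by (simp add: W_def borel_graphon_def)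
    moreover have "W \<sigma> s t \<in> {0..1}" if "\<sigma> \<in> perms n" for \<sigma> s t
    proof -
      have K0: "0 \<le> K \<sigma> s t" for \<sigma>
        using K[of \<sigma>] by (simp add: borel_graphon_def)
      have "K \<sigma> s t \<le> (\<Sum>\<sigma>\<in>perms n. K \<sigma> s t)"
        using that K0 finite_perms by (intro member_le_sum) auto
      then show ?thesis
        using K0[of \<sigma>] N a0 by (simp add: sumK W_def)
    qed
    ultimately have W: "borel_graphon (W \<sigma>)" if "\<sigma> \<in> perms n" for \<sigma>
      using that by (auto simp: borel_graphon_def)
    obtain h where h: "bij_betw h {1..N} (perms n)"
      using ex_bij_betw_nat_finite_1[OF finite_perms[of n]] by (auto simp: N_def)
    have hm: "h i \<in> perms n" if "i \<in> {1..N}" for i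
      using h that by (auto simp: bij_betw_def)
    have "(\<Sum>i=1..N. W (h i) s t) = 1" for s t
    proof -
      have "(\<Sum>i=1..N. W (h i) s t) = (\<Sum>\<sigma>\<in>perms n. W \<sigma> s t)"
        by (rule sum.reindex_bij_betw[OF h])
      also have "\<dots> = 1"
        using N a0 by (simp add: W_def sumK flip: sum_divide_distrib)
      finally show ?thesis .
    qed
    then have "real N powi (- int m + 1) \<le> (\<Sum>i=1..N. hom_density H (W (h i)))"
      unfolding m_def
      by (intro kc[folded N_def, unfolded k_common_def, THEN spec[of _ "\<lambda>i. W (h i)"], THEN mp])
        (simp add: borel_graphon_imp_graphon W hm)
    also have "\<dots> = (\<Sum>\<sigma>\<in>perms n. hom_density H (W \<sigma>))"
      by (rule sum.reindex_bij_betw[OF h])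
    also have "\<dots> = (\<Sum>\<sigma>\<in>perms n. (\<integral>y. edge_prod H (K \<sigma>) y \<partial>cube (verts H)) / (N * a) ^ m)"
    proof (intro sum.cong refl)
      fix \<sigma> assume "\<sigma> \<in> perms n"
      then have "hom_density H (W \<sigma>) = (\<integral>y. edge_prod H (W \<sigma>) y \<partial>cube (verts H))"
        by (intro hom_density_borel_graphon H W)
      also have "\<dots> = (\<integral>y. edge_prod H (K \<sigma>) y / (N * a) ^ m \<partial>cube (verts H))"
        unfolding W_def[abs_def] edge_prod_scale m_def ..
      finally show "hom_density H (W \<sigma>) = (\<integral>y. edge_prod H (K \<sigma>) y \<partial>cube (verts H)) / (N * a) ^ m"
        by simp
    qed
    finally have "real N * (1 / real N) ^ m * (N * a) ^ m
        \<le> (\<Sum>\<sigma>\<in>perms n. \<integral>y. edge_prod H (K \<sigma>) y \<partial>cube (verts H))"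
      using N a0 by (simp add: real_powi_one_minus[symmetric] pos_le_divide_eq flip: sum_divide_distrib)
    then show ?thesis
      using N by (simp add: power_mult_distrib power_one_over)
  qed
  then show ?thesis
    by (simp add: N_def a_def m_def K_def)
qed

section \<open>Random sampling, and the limit of fine partitions\<close>

text \<open>The bound for step kernels is applied to the matrix \<open>U x\<close> of values of
  \<open>W\<close> at a random sample \<open>x\<close> and then integrated over \<open>x\<close>.
  Placements \<open>y\<close> with two vertices in one block get the crude bound 1.\<close>

lemma real_le_edge_prod_block_kernel:
  assumes H: "finite_simple_graph H" and W: "borel_graphon W" and n: "1 \<le> n"
    and kc: "k_common (card (perms n)) H"
  defines "t \<equiv> hom_density H W"
  shows "hom_density K2 W ^ card (edges H) \<le>
    (\<integral>y. (if inj_on (block n \<circ> y) (verts H) then t else 1) \<partial>cube (verts H))"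
proof -
  let ?X = "cube (UNIV :: nat set)" and ?Y = "cube (verts H)"
  interpret X: prob_space ?X by (rule prob_space_cube)
  interpret Y: prob_space ?Y by (rule prob_space_cube)
  interpret XY: pair_prob_space ?X ?Y ..
  define N where "N = real (card (perms n))"
  note N = card_perms_pos[of n, folded N_def]
  define m where "m = card (edges H)"
  define p where "p = hom_density K2 W"
  define U where "U x i j = W (x i) (x j)" for x :: "nat \<Rightarrow> real" and i j :: nat
  define a where "a x = perm_mean n (U x)" for x
  define F where "F \<sigma> x y = edge_prod H (block_kernel n (a x) (U x) \<sigma>) y" for \<sigma> x y
  define G where "G y = (if inj_on (block n \<circ> y) (verts H) then t else 1)" for y
  have Ur: "U x i j \<in> {0..1}" and Us: "U x i j = U x j i" for x i j
    using W by (auto simp: U_def borel_graphon_def)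
  have Um [measurable]: "(\<lambda>x. U x i j) \<in> borel_measurable ?X" for i j
    unfolding U_def by (intro borel_graphon_measurable[OF W] measurable_cube_component) auto
  have Ui: "integrable ?X (\<lambda>x. U x i j)" for i j
    using Ur by (intro X.integrable_const_bound[where B = 1] AE_I2 Um) auto
  have a01: "0 \<le> a x" "a x \<le> 1" for x
    using perm_mean_bounds[OF Ur] by (auto simp: a_def)
  have am [measurable]: "a \<in> borel_measurable ?X"
    unfolding a_def[abs_def] perm_mean_def by measurable
  have ai: "integrable ?X a"
    using a01 by (intro X.integrable_const_bound[where B = 1] AE_I2 am) auto
  have inj\<sigma>: "inj \<sigma>" if "\<sigma> \<in> perms n" for \<sigma>
    using that by (auto simp: perms_def dest: permutes_inj)
  have "(\<integral>x. a x \<partial>?X) = (\<Sum>\<sigma>\<in>perms n. \<integral>x. U x (\<sigma> 0) (\<sigma> 1) \<partial>?X) / N"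
    using Ui by (simp add: a_def perm_mean_def N_def)
  \<comment> \<open>\<open>\<sigma> 0\<close> and \<open>\<sigma> 1\<close> are distinct indices, so
    each summand is the edge density of \<open>W\<close>.\<close>
  also have "\<dots> = (\<Sum>\<sigma>\<in>perms n. p) / N"
    unfolding U_def p_def
    by (intro arg_cong2[where f = "(/)"] sum.cong refl integral_cube_pair_eq_K2[OF W])
      (use inj\<sigma> in \<open>auto simp: inj_eq\<close>)
  also have "\<dots> = p"
    using N by (simp add: N_def)
  finally have mean_a: "(\<integral>x. a x \<partial>?X) = p" .
  have p0: "p \<ge> 0"
    unfolding mean_a[symmetric] using a01 by (intro integral_nonneg_AE) auto
  have t01: "0 \<le> t" "t \<le> 1"
  proof -
    show "0 \<le> t"
      unfolding t_def hom_density_borel_graphon[OF H W]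
      using edge_prod_bounds[OF W] by (intro integral_nonneg_AE) auto
    have "t \<le> (\<integral>y. 1 \<partial>?Y)"
      unfolding t_def hom_density_borel_graphon[OF H W]
      using edge_prod_bounds[OF W] by (intro integral_mono integrable_edge_prod H W) auto
    then show "t \<le> 1" by (simp add: Y.prob_space)
  qed
  have am_int: "integrable ?X (\<lambda>x. a x ^ m)"
    using a01 by (intro X.integrable_const_bound[where B = 1] AE_I2)
      (auto simp: power_le_one intro: borel_measurable_power am)
  have bm: "(\<lambda>z. block n (snd z v)) \<in> measurable (?X \<Otimes>\<^sub>M ?Y) (count_space UNIV)" if "v \<in> verts H" for v
    by (intro measurable_compose[OF _ block_measurable]
      measurable_compose[OF measurable_snd measurable_cube_component] that)
  \<comment> \<open>Joint measurability: each factor is measurable for fixed block indices, and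
    those take countably many values.\<close>
  have Fm: "(\<lambda>(x, y). F \<sigma> x y) \<in> borel_measurable (?X \<Otimes>\<^sub>M ?Y)" for \<sigma>
  proof -
    let ?k = "\<lambda>i j z. if i = j then a (fst z) else U (fst z) (\<sigma> i) (\<sigma> j)"
    have k: "?k i j \<in> borel_measurable (?X \<Otimes>\<^sub>M ?Y)" for i j
      by measurable
    have "(\<lambda>z. ?k (block n (snd z u)) (block n (snd z v)) z) \<in> borel_measurable (?X \<Otimes>\<^sub>M ?Y)"
      if "u \<in> verts H" "v \<in> verts H" for u v
      by (rule measurable_compose_countable[OF measurable_compose_countable[OF k bm[OF that(2)]] bm[OF that(1)]])
    then show ?thesis
      unfolding F_def edge_prod_def block_kernel_def case_prod_unfold
      by (intro borel_measurable_prod) (use edge_ends[OF H] in blast)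
  qed
  have F01: "0 \<le> F \<sigma> x y" "F \<sigma> x y \<le> 1" for \<sigma> x y
    unfolding F_def using Us Ur a01
    by (auto intro!: edge_prod_bounds borel_graphon_block_kernel)
  have Fi: "integrable (?X \<Otimes>\<^sub>M ?Y) (\<lambda>(x, y). F \<sigma> x y)" for \<sigma>
    using F01 by (intro XY.integrable_const_bound[where B = 1] AE_I2 Fm) auto
  \<comment> \<open>With \<open>y\<close> fixed and injective on blocks, no edge meets a diagonal
    block, and the vertices read off distinct sample points.\<close>
  have FG: "(\<integral>x. F \<sigma> x y \<partial>?X) \<le> G y" if \<sigma>: "\<sigma> \<in> perms n" for \<sigma> y
  proof (cases "inj_on (block n \<circ> y) (verts H)")
    case True
    let ?f = "\<sigma> \<circ> (block n \<circ> y)"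
    have "block n (y (src e)) \<noteq> block n (y (tgt e))" if "e \<in> edges H" for e
      using edge_ends[OF H that] inj_onD[OF True, of "src e" "tgt e"] by auto
    then have "F \<sigma> x y = edge_prod H W (x \<circ> ?f)" for x
      unfolding F_def edge_prod_def block_kernel_def U_def by (intro prod.cong) simp_all
    moreover have "inj_on ?f (verts H)"
      using True inj\<sigma>[OF \<sigma>] by (rule comp_inj_on[OF _ inj_on_subset]) auto
    ultimately have "(\<integral>x. F \<sigma> x y \<partial>?X) = t"
      unfolding t_def hom_density_borel_graphon[OF H W]
      using integral_cube_reindex[OF H W, of ?f UNIV] by simp
    then show ?thesis using True by (simp add: G_def)
  next
    case False
    have "(\<integral>x. F \<sigma> x y \<partial>?X) \<le> (\<integral>x. 1 \<partial>?X)"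
      using F01 by (intro integral_mono') auto
    then show ?thesis using False by (simp add: G_def X.prob_space)
  qed
  have Gi: "integrable ?Y G"
    unfolding G_def using t01 inj_block_measurable[of "verts H" n] H
    by (intro Y.integrable_const_bound[where B = 1] AE_I2 measurable_If)
      (auto simp: finite_simple_graph_def pred_def)
  \<comment> \<open>Jensen's inequality for \<open>a\<close>: the tangent at the mean
    \<open>p\<close> integrates to \<open>p ^ m\<close>.\<close>
  have "p ^ m = (\<integral>x. p ^ m + real m * p ^ (m - 1) * (a x - p) \<partial>?X)"
    using ai mean_a by (simp add: X.prob_space)
  also have "\<dots> \<le> (\<integral>x. a x ^ m \<partial>?X)"
    using ai am_int a01 p0 by (intro integral_mono power_ge_tangent) auto
  also have "\<dots> \<le> (\<integral>x. (\<Sum>\<sigma>\<in>perms n. \<integral>y. F \<sigma> x y \<partial>?Y) / N \<partial>?X)"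
  proof (intro integral_mono am_int)
    show "integrable ?X (\<lambda>x. (\<Sum>\<sigma>\<in>perms n. \<integral>y. F \<sigma> x y \<partial>?Y) / N)"
      using XY.integrable_fst[OF Fi] by auto
    show "a x ^ m \<le> (\<Sum>\<sigma>\<in>perms n. \<integral>y. F \<sigma> x y \<partial>?Y) / N" for x
      using k_common_imp_block_kernel_bound[OF H kc Us Ur, of x] N
      by (simp add: F_def a_def N_def m_def pos_le_divide_eq mult.commute)
  qed
  also have "\<dots> = (\<Sum>\<sigma>\<in>perms n. \<integral>x. (\<integral>y. F \<sigma> x y \<partial>?Y) \<partial>?X) / N"
    using XY.integrable_fst[OF Fi] by simp
  \<comment> \<open>Fubini puts the sample \<open>x\<close> inside, where \<open>FG\<close>
    evaluates or bounds its integral.\<close>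
  also have "\<dots> = (\<Sum>\<sigma>\<in>perms n. \<integral>y. (\<integral>x. F \<sigma> x y \<partial>?X) \<partial>?Y) / N"
    using XY.Fubini_integral[OF Fi] by simp
  also have "\<dots> \<le> (\<Sum>\<sigma>\<in>perms n. \<integral>y. G y \<partial>?Y) / N"
    using N FG XY.integrable_snd[OF Fi] Gi
    by (intro divide_right_mono sum_mono integral_mono) auto
  also have "\<dots> = (\<integral>y. G y \<partial>?Y)"
    using N by (simp add: N_def)
  finally show ?thesis
    by (simp add: p_def m_def G_def)
qed

text \<open>The upper bound \<open>G n\<close> tends to the density of \<open>H\<close> almost
  everywhere as the blocks shrink, so dominated convergence removes the contribution of colliding
  vertices.\<close>

lemma k_common_imp_sidorenko:
  assumes H: "finite_simple_graph H" and kc: "\<And>k. k \<ge> 2 \<Longrightarrow> k_common k H"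
  shows "sidorenko H"
  unfolding sidorenko_def
proof (intro allI impI)
  fix W assume "graphon W"
  then obtain V where V: "borel_graphon V"
    and ae: "AE z in unit_measure \<Otimes>\<^sub>M unit_measure. W (fst z) (snd z) = V (fst z) (snd z)"
    by (rule graphon_borel_version)
  let ?t = "hom_density H V" and ?Y = "cube (verts H)"
  define G where "G n y = (if inj_on (block n \<circ> y) (verts H) then ?t else 1)" for n y
  interpret Y: prob_space ?Y by (rule prob_space_cube)
  have fin: "finite (verts H)"
    using H by (simp add: finite_simple_graph_def)
  have "(\<lambda>n. \<integral>y. G n y \<partial>?Y) \<longlonglongrightarrow> (\<integral>y. ?t \<partial>?Y)"
  proof (rule integral_dominated_convergence[where w = "\<lambda>_. max \<bar>?t\<bar> 1"])
    show "AE y in ?Y. (\<lambda>n. G n y) \<longlonglongrightarrow> ?t"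
      using AE_cube_inj_on[OF fin] AE_space
    proof eventually_elim
      case (elim y)
      have "eventually (\<lambda>n. \<forall>u\<in>verts H. \<forall>v\<in>verts H. u \<noteq> v \<longrightarrow> block n (y u) \<noteq> block n (y v)) sequentially"
      proof (intro eventually_ball_finite fin ballI)
        fix u v assume uv: "u \<in> verts H" "v \<in> verts H"
        show "eventually (\<lambda>n. u \<noteq> v \<longrightarrow> block n (y u) \<noteq> block n (y v)) sequentially"
          using block_eventually_neq[of "y u" "y v"] space_cubeD[OF elim(2)] uv inj_onD[OF elim(1), of u v]
          by (cases "u = v") auto
      qed
      then have "eventually (\<lambda>n. G n y = ?t) sequentially"
        by eventually_elim (auto simp: G_def inj_on_def)
      then show ?case
        by (rule tendsto_eventually)
    qed
    show "G n \<in> borel_measurable ?Y" for n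
      unfolding G_def[abs_def] using inj_block_measurable[OF fin, of n]
      by (intro measurable_If) (auto simp: pred_def)
  qed (auto simp: G_def)
  then have lim: "(\<lambda>n. \<integral>y. G n y \<partial>?Y) \<longlonglongrightarrow> ?t"
    by (simp add: Y.prob_space)
  have "hom_density K2 V ^ card (edges H) \<le> ?t"
  proof (rule tendsto_lowerbound[OF lim])
    show "eventually (\<lambda>n. hom_density K2 V ^ card (edges H) \<le> (\<integral>y. G n y \<partial>?Y)) sequentially"
      using eventually_ge_at_top[of 1]
    proof eventually_elim
      case (elim n)
      \<comment> \<open>The number of colours is the factorial of \<open>Suc n\<close>, hence at
        least 2.\<close>
      have "2 \<le> Suc n" using elim by simp
      also have "\<dots> \<le> card (perms n)"
        unfolding card_perms by (rule fact_ge_self)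
      finally have "k_common (card (perms n)) H"
        by (rule kc)
      then show ?case
        unfolding G_def by (intro real_le_edge_prod_block_kernel H V elim)
    qed
  qed simp
  \<comment> \<open>Passing back from the Borel version \<open>V\<close> changes neither
    density.\<close>
  then show "hom_density K2 W ^ card (edges H) \<le> hom_density H W"
    using hom_density_eq[OF _ \<open>graphon W\<close> V ae] hom_density_borel_graphon[OF _ V]
      finite_simple_graph_K2 H by metis
qed

theorem theorem2:
  fixes H :: "'v graph"
  assumes "finite_simple_graph H"
  shows "(\<forall>k\<ge>2. k_common k H) \<longleftrightarrow> sidorenko H"
  using assms k_common_imp_sidorenko sidorenko_imp_k_common by fastforce

end
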